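(* Let $n\ge 2$ be an integer and $\alpha>0$. For every step-size $\eta\ge \dfrac{3(n-1)}{n^2\alpha^2}$, the one-dimensional discrete-time dynamical system $$x^{t+1}=f(x^t),\qquad f(x):=x+\eta\left(\frac{n-1}{n^2x}-\alpha\right),$$ which describes the symmetric Gradient Ascent dynamic with $n$ firms and marginal cost $\alpha$, is Li-Yorke chaotic; that is, there is a compact set $X\subset(0,\infty)$ with $f(X)\subseteq X$ such that the system given by $f:X\to X$ is Li-Yorke chaotic.
   Context: Setting: one good and $n$ firms; firm $i$ produces quantity $x_i$ and has utility $u_i(\mathbf x)=x_i/(\sum_k x_k)-\alpha x_i$. The Gradient Ascent (GA) rule with step-size $\eta$ is $x_i^{t+1}=x_i^t+\eta\,\partial u_i(\mathbf x^t)/\partial x_i$. A symmetric GA dynamic is one whose initial point has all $x_i^0$ equal; then all $x_i^t$ remain equal for every $t$, and their common value evolves by the map $f$ of the claim. Li-Yorke chaos: a discrete-time dynamical system $(x^t)_{t\in\mathbb N}$ with $x^t=f^t(x^0)$ ($f^t$ the $t$-fold iterate), for a continuous update rule $f:X\to X$ on a compact set $X\subseteq\mathbb R$, is Li-Yorke chaotic if (i) for each $k\in\mathbb N$, $k\ge1$, there is a periodic point $\hat x\in X$ with period $k$, and (ii) there is an uncountably infinite set $S\subset X$ that is scrambled, i.e. for all $x\ne x'$ in $S$, $\liminf_{t\to\infty}|f^t(x)-f^t(x')|=0<\limsup_{t\to\infty}|f^t(x)-f^t(x')|$. *)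

theory Defs
  imports "HOL-Analysis.Analysis"
begin

definition utility :: "nat \<Rightarrow> real \<Rightarrow> nat \<Rightarrow> (nat \<Rightarrow> real) \<Rightarrow> real" where
  "utility n \<alpha> i x = x i / (\<Sum>k<n. x k) - \<alpha> * x i"

definition GA_step :: "nat \<Rightarrow> real \<Rightarrow> real \<Rightarrow> (nat \<Rightarrow> real) \<Rightarrow> nat \<Rightarrow> real" where
  "GA_step n \<alpha> \<eta> x i = x i + \<eta> * deriv (\<lambda>y. utility n \<alpha> i (x(i := y))) (x i)"

definition GA_sym :: "nat \<Rightarrow> real \<Rightarrow> real \<Rightarrow> real \<Rightarrow> real" where
  "GA_sym n \<alpha> \<eta> x = x + \<eta> * ((real n - 1) / ((real n)\<^sup>2 * x) - \<alpha>)"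

lemma GA_step_symmetric:
  assumes "i < n" and "x > 0" and sym: "\<And>k. k < n \<Longrightarrow> v k = x"
  shows "GA_step n \<alpha> \<eta> v i = GA_sym n \<alpha> \<eta> x"
proof -
  have vi: "v i = x" using assms by auto
  have n0: "real n > 0" using assms by auto
  have s: "(\<Sum>k<n. (v(i := y)) k) = y + (real n - 1) * x" for y
  proof -
    have "(\<Sum>k<n. (v(i := y)) k) = (v(i := y)) i + (\<Sum>k\<in>{..<n} - {i}. (v(i := y)) k)"
      using assms by (intro sum.remove) auto
    also have "(\<Sum>k\<in>{..<n} - {i}. (v(i := y)) k) = (\<Sum>k\<in>{..<n} - {i}. x)"
      using sym by (intro sum.cong) auto
    also have "\<dots> = (real n - 1) * x"
      using assms by (simp add: of_nat_diff)
    finally show ?thesis by simp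
  qed
  have ne: "x + (real n - 1) * x \<noteq> 0"
  proof -
    have "x + (real n - 1) * x = real n * x" by (simp add: algebra_simps)
    then show ?thesis using n0 assms by simp
  qed
  have "((\<lambda>y. y / (y + (real n - 1) * x) - \<alpha> * y) has_field_derivative
      ((x + (real n - 1) * x) - x) / (x + (real n - 1) * x)\<^sup>2 - \<alpha>) (at x)"
    using ne by (auto intro!: derivative_eq_intros simp: power2_eq_square)
  then have "deriv (\<lambda>y. utility n \<alpha> i (v(i := y))) x =
      ((x + (real n - 1) * x) - x) / (x + (real n - 1) * x)\<^sup>2 - \<alpha>"
    unfolding utility_def s by (intro DERIV_imp_deriv) simp
  also have "x + (real n - 1) * x = real n * x" by (simp add: algebra_simps)
  also have "(real n * x - x) / (real n * x)\<^sup>2 - \<alpha> = (real n - 1) / ((real n)\<^sup>2 * x) - \<alpha>"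
    using n0 assms(2) by (simp add: field_simps power2_eq_square)
  finally show ?thesis
    unfolding GA_step_def GA_sym_def vi by (simp only:)
qed

text \<open>A period is understood as the least one; otherwise a single fixed point would be
  periodic with every period.\<close>

definition periodic_point :: "(real \<Rightarrow> real) \<Rightarrow> nat \<Rightarrow> real \<Rightarrow> bool" where
  "periodic_point f k x \<longleftrightarrow>
     k \<ge> 1 \<and> (f ^^ k) x = x \<and> (\<forall>j. 1 \<le> j \<and> j < k \<longrightarrow> (f ^^ j) x \<noteq> x)"

text \<open>The lower and upper limits are taken in the extended reals, since the real-valued
  ones are meaningless for unbounded sequences.\<close>

definition scrambled :: "(real \<Rightarrow> real) \<Rightarrow> real set \<Rightarrow> bool" where
  "scrambled f S \<longleftrightarrow> (\<forall>x\<in>S. \<forall>x'\<in>S. x \<noteq> x' \<longrightarrow>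
     liminf (\<lambda>t. ereal \<bar>(f ^^ t) x - (f ^^ t) x'\<bar>) = 0 \<and>
     0 < limsup (\<lambda>t. ereal \<bar>(f ^^ t) x - (f ^^ t) x'\<bar>))"

definition Li_Yorke_chaotic :: "real set \<Rightarrow> (real \<Rightarrow> real) \<Rightarrow> bool" where
  "Li_Yorke_chaotic X f \<longleftrightarrow>
     compact X \<and> continuous_on X f \<and> f ` X \<subseteq> X \<and>
     (\<forall>k\<ge>1. \<exists>x\<in>X. periodic_point f k x) \<and>
     (\<exists>S\<subseteq>X. uncountable S \<and> scrambled f S)"

end

theory Submission
  imports Defs
begin

text \<open>Rescaled by its fixed point \<open>e\<close>, the map is \<open>y + r / y - r\<close> with \<open>r \<ge> 3\<close>. It has points
  \<open>p < 1 < q < w\<close> with \<open>f q \<le> p\<close>, \<open>f p \<ge> w\<close> and \<open>f w \<ge> q\<close>, so the intervals \<open>{p..1}\<close>, \<open>{1..q}\<close>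
  and \<open>{q..w}\<close> cover each other as for a 3-cycle, which yields points of every period. Since the
  fixed point repels, \<open>q\<close> has a backward orbit converging to it inside \<open>{p..q}\<close>. Itineraries that
  start ever closer to the fixed point, move away from it and then either visit \<open>{q..w}\<close> or do
  not, according to the next bit of a code, give the scrambled set. The interval \<open>{p..w}\<close> is not
  invariant (for \<open>r \<ge> 4\<close> the map even takes nonpositive values on it), so the compact set is that
  of the points whose whole orbit stays in it.\<close>

section \<open>Itineraries through compact sets\<close>

text \<open>Preimages are taken one step at a time, since \<open>f\<close> is assumed continuous
  only on the sets of the itinerary.\<close>

fun following :: "('a::t2_space \<Rightarrow> 'a) \<Rightarrow> nat \<Rightarrow> (nat \<Rightarrow> 'a set) \<Rightarrow> 'a set" where
  "following f 0 I = I 0"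
| "following f (Suc n) I = I 0 \<inter> f -` following f n (\<lambda>t. I (Suc t))"

lemma following_iff: "x \<in> following f n I \<longleftrightarrow> (\<forall>t\<le>n. (f ^^ t) x \<in> I t)"
proof (induction n arbitrary: x I)
  case (Suc n)
  have "(\<forall>t\<le>Suc n. P t) \<longleftrightarrow> P 0 \<and> (\<forall>t\<le>n. P (Suc t))" for P
    by (metis Suc_le_mono le0 not0_implies_Suc)
  from this[of "\<lambda>t. (f ^^ t) x \<in> I t"] show ?case
    by (simp add: Suc.IH funpow_swap1)
qed simp

lemma following_subset: "following f n I \<subseteq> I 0"
  by (cases n) auto

lemma compact_Int_vimage:
  fixes f :: "'a::t2_space \<Rightarrow> 'b::topological_space"
  assumes "compact S" and "continuous_on S f" and "closed T"
  shows "compact (S \<inter> f -` T)"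
  using compact_Int_closed[OF assms(1) continuous_closed_preimage[OF assms(2) _ assms(3)]]
    assms(1) by (simp add: compact_imp_closed inf.absorb2)

lemma compact_following:
  assumes "\<And>t. compact (I t)" and "\<And>t. continuous_on (I t) f"
  shows "compact (following f n I)"
  using assms
proof (induction n arbitrary: I)
  case (Suc n)
  have "compact (following f n (\<lambda>t. I (Suc t)))"
    by (intro Suc.IH Suc.prems)
  then show ?case
    unfolding following.simps by (intro compact_Int_vimage Suc.prems compact_imp_closed)
qed simp

lemma following_nonempty:
  assumes "\<And>t. I t \<noteq> {}" and "\<And>t. I (Suc t) \<subseteq> f ` I t"
  shows "following f n I \<noteq> {}"
  using assms
proof (induction n arbitrary: I)
  case (Suc n)
  obtain y where y: "y \<in> following f n (\<lambda>t. I (Suc t))"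
    using Suc.IH[of "\<lambda>t. I (Suc t)"] Suc.prems by blast
  then have "y \<in> I (Suc 0)"
    by (auto simp: following_iff dest!: spec[of _ 0])
  then show ?case using y Suc.prems(2)[of 0] by auto
qed simp

text \<open>The points that comply for the first \<open>n\<close> steps form a decreasing sequence
  of nonempty compact sets; a point of the intersection complies forever.\<close>

lemma exists_itinerary:
  fixes f :: "'a::heine_borel \<Rightarrow> 'a"
  assumes "\<And>t. compact (I t)" and "\<And>t. I t \<noteq> {}" and "\<And>t. continuous_on (I t) f"
    and "\<And>t. I (Suc t) \<subseteq> f ` I t"
  obtains x where "\<And>t. (f ^^ t) x \<in> I t"
proof -
  have "\<Inter> (range (\<lambda>n. following f n I)) \<noteq> {}"
  proof (rule compact_nest)
    show "following f n I \<subseteq> following f m I" if "m \<le> n" for m n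
      using that by (auto simp: following_iff)
  qed (intro compact_following following_nonempty assms)+
  then obtain x where "\<And>n. x \<in> following f n I" by blast
  then show thesis using that unfolding following_iff by blast
qed

lemma compact_confined:
  fixes f :: "'a::heine_borel \<Rightarrow> 'a"
  assumes "compact K" and "continuous_on K f"
  shows "compact {x. \<forall>t. (f ^^ t) x \<in> K}"
proof -
  have "{x. \<forall>t. (f ^^ t) x \<in> K} = (\<Inter>n. following f n (\<lambda>_. K))"
    unfolding set_eq_iff INT_iff mem_Collect_eq following_iff by blast
  then show ?thesis
    using assms compact_following[of "\<lambda>_. K" f] by (auto intro!: compact_Inter)
qed

section \<open>Periodic points from loops of intervals\<close>

lemma segment_image_real:
  fixes f :: "real \<Rightarrow> real"
  assumes "continuous_on (closed_segment u v) f"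
  shows "closed_segment (f u) (f v) \<subseteq> f ` closed_segment u v"
proof -
  have "connected (f ` closed_segment u v)"
    using assms by (intro connected_continuous_image) auto
  then show ?thesis
    by (intro closed_segment_subset) (auto simp: is_interval_connected_1 simp flip: is_interval_convex_1)
qed

lemma interval_image_real:
  fixes f :: "real \<Rightarrow> real"
  assumes "continuous_on {a..b} f" and "x \<in> {a..b}" and "y \<in> {a..b}" and "f x \<le> c" and "d \<le> f y"
  shows "{c..d} \<subseteq> f ` {a..b}"
proof -
  have sub: "closed_segment x y \<subseteq> {a..b}"
    using assms(2,3) by (auto simp: closed_segment_eq_real_ivl split: if_splits)
  have "{c..d} \<subseteq> closed_segment (f x) (f y)"
    using assms(4,5) by (auto simp: closed_segment_eq_real_ivl)
  also have "\<dots> \<subseteq> f ` closed_segment x y"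
    using assms(1) sub by (intro segment_image_real) (rule continuous_on_subset)
  finally show ?thesis using sub by blast
qed

text \<open>Let \<open>u\<close> be the last point with value \<open>c\<close> and \<open>v\<close>
  the first point after \<open>u\<close> with value \<open>d\<close>. Leaving \<open>{c..d}\<close>
  in between would, by the intermediate value theorem, force a later \<open>c\<close> or an earlier
  \<open>d\<close>.\<close>

lemma subinterval_onto_increasing:
  fixes f :: "real \<Rightarrow> real"
  assumes cont: "continuous_on {x..y} f" and "x \<le> y" and c: "f x = c" and d: "f y = d" and cd: "c \<le> d"
  obtains u v where "u \<le> v" and "{u..v} \<subseteq> {x..y}" and "f ` {u..v} = {c..d}"
proof -
  define C where "C = {x..y} \<inter> f -` {c}"
  have "compact C" unfolding C_def using cont by (intro compact_Int_vimage) auto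
  have "x \<in> C" unfolding C_def using assms(2,3) by simp
  then obtain u where u: "u \<in> C" "\<And>t. t \<in> C \<Longrightarrow> t \<le> u"
    using \<open>compact C\<close> compact_attains_sup[of C] by blast
  define D where "D = {u..y} \<inter> f -` {d}"
  have uy: "x \<le> u" "u \<le> y" "f u = c" using u(1) C_def by auto
  have contu: "continuous_on {u..y} f" by (rule continuous_on_subset[OF cont]) (use uy in auto)
  have "compact D" unfolding D_def using contu by (intro compact_Int_vimage) auto
  have "y \<in> D" unfolding D_def using assms(4) uy by simp
  then obtain v where v: "v \<in> D" "\<And>t. t \<in> D \<Longrightarrow> v \<le> t"
    using \<open>compact D\<close> compact_attains_inf[of D] by blast
  have uv: "u \<le> v" "v \<le> y" "f v = d" using v(1) D_def by auto
  have contt: "continuous_on {s..t} f" if "u \<le> s" "t \<le> v" for s t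
    by (rule continuous_on_subset[OF cont]) (use uy uv that in auto)
  have "f t \<in> {c..d}" if t: "t \<in> {u..v}" for t
  proof (rule ccontr)
    assume "f t \<notin> {c..d}"
    then consider "f t < c" | "d < f t" by fastforce
    then show False
    proof cases
      case 1
      have "\<exists>s\<ge>t. s \<le> v \<and> f s = c"
        by (rule IVT') (use 1 t uv cd contt[of t v] in auto)
      then obtain s where "t \<le> s" "s \<le> v" and s: "f s = c" by blast
      then have "s \<in> C" unfolding C_def using t uy uv by simp
      then have "s = t" using u(2)[of s] t \<open>t \<le> s\<close> by simp
      then show False using 1 s by simp
    next
      case 2
      have "\<exists>s\<ge>u. s \<le> t \<and> f s = d"
        by (rule IVT') (use 2 t uy cd contt[of u t] in auto)
      then obtain s where "u \<le> s" "s \<le> t" and s: "f s = d" by blast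
      then have "s \<in> D" unfolding D_def using t uy uv by simp
      then have "s = t" using v(2)[of s] t \<open>s \<le> t\<close> by simp
      then show False using 2 s by simp
    qed
  qed
  moreover have "{c..d} \<subseteq> f ` {u..v}"
    using interval_image_real[of u v f u v c d] contt[of u v] uv uy by auto
  ultimately have "f ` {u..v} = {c..d}" by blast
  moreover have "{u..v} \<subseteq> {x..y}" using uv uy by auto
  ultimately show thesis using that uv(1) by blast
qed

lemma subinterval_onto:
  fixes f :: "real \<Rightarrow> real"
  assumes cont: "continuous_on {a..b} f" and sub: "{c..d} \<subseteq> f ` {a..b}" and "c \<le> d"
  obtains u v where "u \<le> v" and "{u..v} \<subseteq> {a..b}" and "f ` {u..v} = {c..d}"
proof -
  have "c \<in> f ` {a..b}" "d \<in> f ` {a..b}" using sub \<open>c \<le> d\<close> by auto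
  then obtain x y where xy: "x \<in> {a..b}" "y \<in> {a..b}" "f x = c" "f y = d" by blast
  show thesis
  proof (cases "x \<le> y")
    case True
    moreover have "continuous_on {x..y} f" by (rule continuous_on_subset[OF cont]) (use xy in auto)
    ultimately obtain u v where "u \<le> v" "{u..v} \<subseteq> {x..y}" "f ` {u..v} = {c..d}"
      using subinterval_onto_increasing[of x y f c d] xy \<open>c \<le> d\<close> by blast
    moreover have "{x..y} \<subseteq> {a..b}" using xy by auto
    ultimately show thesis using that by blast
  next
    case False
    \<comment> \<open>Here \<open>d\<close> is taken to the left of \<open>c\<close>, so the
      increasing case applies to \<open>- f\<close>.\<close>
    have "continuous_on {y..x} (\<lambda>t. - f t)"
      by (rule continuous_on_subset[OF continuous_on_minus[OF cont]]) (use xy in auto)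
    then obtain u v where uv: "u \<le> v" "{u..v} \<subseteq> {y..x}" "(\<lambda>t. - f t) ` {u..v} = {-d..-c}"
      by (rule subinterval_onto_increasing[of y x "\<lambda>t. - f t" "- d" "- c"]) (use False xy \<open>c \<le> d\<close> in simp_all)
    have "f ` {u..v} = uminus ` (\<lambda>t. - f t) ` {u..v}" by (simp add: image_image)
    also have "\<dots> = {c..d}" unfolding uv(3) by simp
    finally have "f ` {u..v} = {c..d}" .
    moreover have "{y..x} \<subseteq> {a..b}" using xy by auto
    ultimately show thesis using that uv by blast
  qed
qed

text \<open>Pulling back from the last interval, each step picks a subinterval mapped exactly onto
  the one found before. Exactness, rather than mere covering, keeps the intermediate images inside
  the prescribed intervals.\<close>

lemma subinterval_following:
  fixes f :: "real \<Rightarrow> real"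
  assumes "\<And>t. l t \<le> h t" and "\<And>t. continuous_on {l t..h t} f"
    and "\<And>t. t < k \<Longrightarrow> {l (Suc t)..h (Suc t)} \<subseteq> f ` {l t..h t}"
  obtains u v where "u \<le> v" and "{u..v} \<subseteq> following f k (\<lambda>t. {l t..h t})"
    and "continuous_on {u..v} (f ^^ k)" and "(f ^^ k) ` {u..v} = {l k..h k}"
  using assms
proof (induction k arbitrary: l h thesis)
  case 0
  show ?case by (rule "0.prems"(1)[of "l 0" "h 0"]) (use "0.prems"(2) in auto)
next
  case (Suc k)
  obtain u v where uv: "u \<le> v" "{u..v} \<subseteq> following f k (\<lambda>t. {l (Suc t)..h (Suc t)})"
    "continuous_on {u..v} (f ^^ k)" "(f ^^ k) ` {u..v} = {l (Suc k)..h (Suc k)}"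
    by (rule Suc.IH[of "\<lambda>t. l (Suc t)" "\<lambda>t. h (Suc t)"]) (simp_all add: Suc.prems(2-4))
  have "{u..v} \<subseteq> {l (Suc 0)..h (Suc 0)}"
    using uv(2) following_subset by blast
  then have "{u..v} \<subseteq> f ` {l 0..h 0}" using Suc.prems(4)[of 0] by blast
  then obtain u' v' where uv': "u' \<le> v'" "{u'..v'} \<subseteq> {l 0..h 0}" "f ` {u'..v'} = {u..v}"
    using subinterval_onto[OF Suc.prems(3)[of 0]] uv(1) by blast
  have "continuous_on {u'..v'} (f ^^ Suc k)"
    unfolding funpow_Suc_right using uv' uv(3) Suc.prems(3)[of 0]
    by (intro continuous_on_compose) (auto intro: continuous_on_subset)
  moreover have "(f ^^ Suc k) ` {u'..v'} = {l (Suc k)..h (Suc k)}"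
    unfolding funpow_Suc_right image_comp[symmetric] uv' uv(4) ..
  moreover have "{u'..v'} \<subseteq> following f (Suc k) (\<lambda>t. {l t..h t})"
    using uv' uv(2) by auto
  ultimately show ?case using Suc.prems(1) uv'(1) by blast
qed

lemma fixed_point_of_loop:
  fixes f :: "real \<Rightarrow> real"
  assumes "\<And>t. l t \<le> h t" and "\<And>t. continuous_on {l t..h t} f"
    and "\<And>t. t < k \<Longrightarrow> {l (Suc t)..h (Suc t)} \<subseteq> f ` {l t..h t}"
    and loop: "l k = l 0" "h k = h 0"
  obtains x where "(f ^^ k) x = x" and "\<And>t. t \<le> k \<Longrightarrow> (f ^^ t) x \<in> {l t..h t}"
proof -
  obtain u v where uv: "u \<le> v" "{u..v} \<subseteq> following f k (\<lambda>t. {l t..h t})"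
    "continuous_on {u..v} (f ^^ k)" "(f ^^ k) ` {u..v} = {l k..h k}"
    by (rule subinterval_following[of l h f k]) (simp_all add: assms(1-3))
  have "{u..v} \<subseteq> {l 0..h 0}" using uv(2) following_subset by blast
  then have "{u..v} \<subseteq> (f ^^ k) ` {u..v}" using uv(4) loop by simp
  then have "u \<in> (f ^^ k) ` {u..v}" "v \<in> (f ^^ k) ` {u..v}" using uv(1) by auto
  then obtain y z where yz: "y \<in> {u..v}" "z \<in> {u..v}" "(f ^^ k) y = u" "(f ^^ k) z = v"
    by blast
  \<comment> \<open>The difference is at most 0 at \<open>y\<close>, which goes to the left end
    \<open>u\<close>, and at least 0 at \<open>z\<close>, which goes to the right end
    \<open>v\<close>.\<close>
  have "{0..0} \<subseteq> (\<lambda>x. (f ^^ k) x - x) ` {u..v}"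
    by (rule interval_image_real[of _ _ _ y z]) (use yz uv in \<open>auto intro!: continuous_intros\<close>)
  then obtain x where "x \<in> {u..v}" "(f ^^ k) x = x" by auto
  then show thesis using that uv(2) unfolding following_iff subset_iff by blast
qed

section \<open>Chaos from a repelling fixed point inside a three-step loop\<close>

text \<open>Only the product of the rates has to exceed 1: the backward orbit built below changes
  sides at every step, so a rate below 1 on one side can be made up for on the other.\<close>

locale repelling_loop =
  fixes f :: "real \<Rightarrow> real" and p e q w \<kappa> \<mu> :: real
  assumes order: "p < e" "e < q" "q < w"
    and cont: "continuous_on {p..w} f"
    and fixed: "f e = e"
    and ends: "w \<le> f p" "f q \<le> p" "q \<le> f w"
    and rates: "\<kappa> > 0" "\<mu> > 0" "\<kappa> * \<mu> > 1"
    and left_rate: "\<And>x. x \<in> {p..e} \<Longrightarrow> \<kappa> * \<bar>x - e\<bar> \<le> \<bar>f x - e\<bar>"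
    and right_rate: "\<And>x. x \<in> {e..q} \<Longrightarrow> \<mu> * \<bar>x - e\<bar> \<le> \<bar>f x - e\<bar>"
begin

section \<open>Covering relations and confined orbits\<close>

lemma cont_Icc: "p \<le> a \<Longrightarrow> b \<le> w \<Longrightarrow> continuous_on {a..b} f"
  by (rule continuous_on_subset[OF cont]) auto

lemma left_covers: "{e..w} \<subseteq> f ` {p..e}"
  by (rule interval_image_real[of _ _ _ e p]) (use order fixed ends cont_Icc in auto)

lemma right_covers: "{p..e} \<subseteq> f ` {e..q}"
  by (rule interval_image_real[of _ _ _ q e]) (use order fixed ends cont_Icc in auto)

lemma outer_covers: "{p..q} \<subseteq> f ` {q..w}"
  by (rule interval_image_real[of _ _ _ q w]) (use order fixed ends cont_Icc in auto)

definition confined :: "real set" where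
  "confined = {x. \<forall>t. (f ^^ t) x \<in> {p..w}}"

lemma compact_confined_set: "compact confined"
  unfolding confined_def using cont by (intro compact_confined) auto

lemma confined_subset: "confined \<subseteq> {p..w}"
  unfolding confined_def by (auto dest: spec[of _ 0])

lemma confined_invariant: "f ` confined \<subseteq> confined"
proof -
  have "(f ^^ t) (f x) \<in> {p..w}" if "x \<in> confined" for x t
    using that unfolding confined_def mem_Collect_eq by (metis funpow_simps_right(2) comp_apply)
  then show ?thesis unfolding confined_def by blast
qed

text \<open>The loop leaves \<open>{q..w}\<close> at once and stays in \<open>{p..e}\<close> and
  \<open>{e..q}\<close>, alternating between them, until time \<open>k\<close>. An earlier return
  can therefore only happen at the common end \<open>q\<close>.\<close>

lemma exists_periodic_point:
  assumes "k \<ge> 1"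
  shows "\<exists>x\<in>confined. periodic_point f k x"
proof (cases "k = 1")
  case True
  have "(f ^^ t) e = e" for t
    by (induction t) (auto simp: fixed)
  then have "e \<in> confined" "periodic_point f k e"
    using True order by (auto simp: periodic_point_def confined_def fixed)
  then show ?thesis by blast
next
  case False
  with assms have k: "k \<ge> 2" by simp
  \<comment> \<open>The parity of \<open>k - t\<close> puts the loop into \<open>{p..e}\<close> at
    time \<open>k - 1\<close>, because the image of that interval reaches
    \<open>{q..w}\<close>.\<close>
  define l where "l t = (if t = 0 \<or> k \<le> t then q else if odd (k - t) then p else e)" for t
  define h where "h t = (if t = 0 \<or> k \<le> t then w else if odd (k - t) then e else q)" for t
  have bounds: "l t \<le> h t" "{l t..h t} \<subseteq> {p..w}" for t
    using order by (auto simp: l_def h_def)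
  have cover: "{l (Suc t)..h (Suc t)} \<subseteq> f ` {l t..h t}" if "t < k" for t
  proof -
    consider "t = 0" | "0 < t" "odd (k - t)" | "0 < t" "even (k - t)" by blast
    then show ?thesis
    proof cases
      case 1
      then have "{l (Suc t)..h (Suc t)} \<subseteq> {p..q}"
        using k order by (auto simp: l_def h_def)
      moreover have "{l t..h t} = {q..w}" using 1 by (simp add: l_def h_def)
      ultimately show ?thesis using outer_covers by (metis order_trans)
    next
      case 2
      then have "{l (Suc t)..h (Suc t)} \<subseteq> {e..w}"
        using that order by (auto simp: l_def h_def)
      moreover have "{l t..h t} = {p..e}" using 2 that by (simp add: l_def h_def)
      ultimately show ?thesis using left_covers by (metis order_trans)
    next
      case 3
      then have "Suc t < k" using that by (cases "Suc t = k") auto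
      moreover have "odd (k - Suc t)" using 3 that by auto
      ultimately show ?thesis using right_covers 3 that by (simp add: l_def h_def)
    qed
  qed
  obtain x where x: "(f ^^ k) x = x" "\<And>t. t \<le> k \<Longrightarrow> (f ^^ t) x \<in> {l t..h t}"
  proof (rule fixed_point_of_loop[of l h f k])
    show "l t \<le> h t" for t by (rule bounds)
    show "continuous_on {l t..h t} f" for t by (rule continuous_on_subset[OF cont bounds(2)])
  qed (use cover in \<open>auto simp: l_def h_def\<close>)
  have "x \<in> confined"
    unfolding confined_def
  proof (intro CollectI allI)
    fix t
    have "(f ^^ t) x = (f ^^ (t mod k)) x" using funpow_mod_eq[OF x(1), of t] by simp
    moreover have "t mod k \<le> k" using k by (simp add: less_imp_le)
    ultimately show "(f ^^ t) x \<in> {p..w}" using x(2) bounds(2) by (metis subsetD)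
  qed
  moreover have "(f ^^ j) x \<noteq> x" if j: "1 \<le> j" "j < k" for j
  proof
    assume eq: "(f ^^ j) x = x"
    have "(f ^^ j) x \<le> q" using x(2)[of j] j order by (auto simp: l_def h_def split: if_splits)
    moreover have "q \<le> x" using x(2)[of 0] by (simp add: l_def)
    ultimately have xq: "x = q" using eq by simp
    have fx: "f x \<in> {l 1..h 1}" using x(2)[of 1] k by simp
    have ffx: "f (f x) \<in> {l 2..h 2}" using x(2)[of 2] k by (simp add: numeral_2_eq_2)
    \<comment> \<open>For odd \<open>k\<close> the first step should land in \<open>{e..q}\<close>,
      but \<open>f q \<le> p\<close>. For even \<open>k\<close> it must land exactly on
      \<open>p\<close>, whose image is at least \<open>w\<close>, although the orbit is at most
      \<open>q\<close> at time 2.\<close>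
    show False
    proof (cases "even k")
      case False
      then have "l 1 = e" using k by (auto simp: l_def)
      then show False using fx xq ends(2) order by simp
    next
      case True
      then have "l 1 = p" using k by (auto simp: l_def)
      then have "f x = p" using fx xq ends(2) by simp
      moreover have "f (f x) \<le> q"
      proof (cases "k = 2")
        case True
        then show ?thesis using x(1) xq by (simp add: numeral_2_eq_2)
      next
        case False
        then have "h 2 = q" using \<open>even k\<close> k by (auto simp: h_def)
        then show ?thesis using ffx by simp
      qed
      ultimately show False using ends(1) order by simp
    qed
  qed
  ultimately show ?thesis using x(1) assms by (auto simp: periodic_point_def)
qed

text \<open>Preimages are chosen alternately in \<open>{p..e}\<close> and \<open>{e..q}\<close>. Two
  steps forward expand the distance to \<open>e\<close> at least by the factor
  \<open>\<kappa> * \<mu>\<close>, so backward the even terms tend to \<open>e\<close>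
  geometrically.\<close>

lemma exists_backward_orbit:
  obtains b where "b 0 = q" and "\<And>k. f (b (Suc k)) = b k"
    and "\<And>k. b k \<in> (if even k then {e..q} else {p..e})"
    and "(\<lambda>k. b (2 * k)) \<longlonglongrightarrow> e" and "b 2 < q"
proof -
  let ?I = "\<lambda>k::nat. if even k then {e..q} else {p..e}"
  have "\<exists>b. \<forall>k. (b k \<in> ?I k \<and> (k = 0 \<longrightarrow> b k = q)) \<and> f (b (Suc k)) = b k"
  proof (rule dependent_nat_choice)
    show "\<exists>x. x \<in> ?I 0 \<and> ((0::nat) = 0 \<longrightarrow> x = q)" using order by auto
    fix x k assume "x \<in> ?I k \<and> (k = 0 \<longrightarrow> x = q)"
    then have "x \<in> f ` ?I (Suc k)"
      using left_covers right_covers order by (auto simp: subset_iff split: if_splits)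
    then show "\<exists>y. (y \<in> ?I (Suc k) \<and> (Suc k = 0 \<longrightarrow> y = q)) \<and> f y = x" by blast
  qed
  then obtain b where b: "\<And>k. b k \<in> ?I k" "b 0 = q" "\<And>k. f (b (Suc k)) = b k" by blast
  have step: "\<kappa> * \<mu> * \<bar>b (2 * Suc k) - e\<bar> \<le> \<bar>b (2 * k) - e\<bar>" for k
  proof -
    have "\<kappa> * (\<mu> * \<bar>b (2 * Suc k) - e\<bar>) \<le> \<kappa> * \<bar>b (Suc (2 * k)) - e\<bar>"
      using right_rate[of "b (2 * Suc k)"] b(1)[of "2 * Suc k"] b(3)[of "Suc (2 * k)"] rates by simp
    also have "\<dots> \<le> \<bar>b (2 * k) - e\<bar>"
      using left_rate[of "b (Suc (2 * k))"] b(1)[of "Suc (2 * k)"] b(3)[of "2 * k"] by simp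
    finally show ?thesis by simp
  qed
  define \<rho> where "\<rho> = 1 / (\<kappa> * \<mu>)"
  have \<rho>: "0 < \<rho>" "\<rho> < 1" using rates by (auto simp: \<rho>_def)
  have step': "\<bar>b (2 * Suc k) - e\<bar> \<le> \<rho> * \<bar>b (2 * k) - e\<bar>" for k
    using step[of k] rates by (simp add: \<rho>_def field_simps)
  have decay: "norm (b (2 * k) - e) \<le> \<rho> ^ k * \<bar>q - e\<bar>" for k
    unfolding real_norm_def
  proof (induction k)
    case (Suc k)
    show ?case
      using order_trans[OF step' mult_left_mono[OF Suc]] \<rho> by (simp add: mult.assoc)
  qed (simp add: b(2))
  have "(\<lambda>k. \<rho> ^ k * \<bar>q - e\<bar>) \<longlonglongrightarrow> 0"
    using \<rho> by (intro tendsto_mult_left_zero LIMSEQ_power_zero) auto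
  with always_eventually[OF allI[OF decay]] have "(\<lambda>k. b (2 * k) - e) \<longlonglongrightarrow> 0"
    by (rule Lim_null_comparison)
  then have "(\<lambda>k. b (2 * k)) \<longlonglongrightarrow> e" by (simp add: LIM_zero_iff)
  moreover have "b 2 < q"
  proof -
    have "b 2 - e \<le> \<rho> * (q - e)"
      using step'[of 0] b(2) order by (simp add: numeral_2_eq_2)
    also have "\<dots> < 1 * (q - e)" using \<rho> order by (intro mult_strict_right_mono) auto
    finally show ?thesis by simp
  qed
  ultimately show thesis using that b by blast
qed

end

text \<open>Every number is the first component of infinitely many decoded pairs, so two different
  sets disagree at infinitely many stages.\<close>

definition code_bit :: "nat set \<Rightarrow> nat \<Rightarrow> bool" where
  "code_bit s n \<longleftrightarrow> fst (prod_decode n) \<in> s"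

text \<open>The value \<open>(n, j)\<close> means step \<open>j\<close> of stage \<open>n\<close>.
  Stage \<open>n\<close> has \<open>2 * n + 4\<close> steps, so it starts at time
  \<open>n * (n + 3)\<close>.\<close>

primrec clock :: "nat \<Rightarrow> nat \<times> nat" where
  "clock 0 = (0, 0)"
| "clock (Suc t) = (case clock t of (n, j) \<Rightarrow> if j < 2 * n + 3 then (n, Suc j) else (Suc n, 0))"

lemma clock_eq: "j \<le> 2 * n + 3 \<Longrightarrow> clock (n * (n + 3) + j) = (n, j)"
proof (induction n arbitrary: j)
  case 0
  then show ?case by (induction j) auto
next
  case (Suc n)
  have "Suc n * (Suc n + 3) = Suc (n * (n + 3) + (2 * n + 3))" by (simp add: algebra_simps)
  then have start: "clock (Suc n * (Suc n + 3)) = (Suc n, 0)"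
    by (simp only: clock.simps Suc.IH[OF order_refl]) simp
  from Suc.prems show ?case
  proof (induction j)
    case 0
    show ?case using start by (simp only: add_0_right)
  next
    case (Suc j)
    have IH: "clock (Suc n * (Suc n + 3) + j) = (Suc n, j)"
      by (rule Suc.IH) (use Suc.prems in simp)
    show ?case unfolding add_Suc_right clock.simps IH using Suc.prems by simp
  qed
qed

lemma clock_bound: "snd (clock t) \<le> 2 * fst (clock t) + 3"
  by (induction t) (auto split: prod.splits)

section \<open>Coded itineraries and the scrambled set\<close>

context repelling_loop
begin

context
  fixes b :: "nat \<Rightarrow> real"
  assumes b0: "b 0 = q" and fb: "\<And>k. f (b (Suc k)) = b k"
    and b_range: "\<And>k. b k \<in> (if even k then {e..q} else {p..e})"
    and b_lim: "(\<lambda>k. b (2 * k)) \<longlonglongrightarrow> e" and b2: "b 2 < q"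
begin

definition approach :: "nat \<Rightarrow> real set" where
  "approach k = closed_segment e (b k)"

text \<open>Since \<open>b (2 * n)\<close> tends to \<open>e\<close>, any two orbits are close when stage \<open>n\<close> starts. At step
  \<open>2 * n + 2\<close> the code bit decides between \<open>{q..w}\<close> and \<open>approach 2\<close>, which, unlike \<open>{e..q}\<close>, has
  a positive distance from \<open>{q..w}\<close>.\<close>

definition stage :: "nat set \<Rightarrow> nat \<times> nat \<Rightarrow> real set" where
  "stage s = (\<lambda>(n, j).
     if j \<le> 2 * n then approach (2 * n - j)
     else if j = 2 * n + 1 then {p..e}
     else if j = 2 * n + 2 then (if code_bit s n then {q..w} else approach 2)
     else (if code_bit s n then {p..e} else approach 1))"

lemma approach_even: "even k \<Longrightarrow> approach k = {e..b k}"
  and approach_odd: "odd k \<Longrightarrow> approach k = {b k..e}"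
  using b_range[of k] by (auto simp: approach_def closed_segment_eq_real_ivl)

lemma approach_even_subset: "even k \<Longrightarrow> approach k \<subseteq> {e..q}"
  and approach_odd_subset: "odd k \<Longrightarrow> approach k \<subseteq> {p..e}"
  using b_range[of k] by (auto simp: approach_even approach_odd)

lemma approach_subset: "approach k \<subseteq> {p..w}"
  using approach_even_subset[of k] approach_odd_subset[of k] order by (cases "even k") force+

lemma approach_covers: "approach k \<subseteq> f ` approach (Suc k)"
  using segment_image_real[of e "b (Suc k)" f] continuous_on_subset[OF cont approach_subset]
  by (simp add: approach_def fixed fb)

lemma stage_cases: "(\<exists>k. stage s c = approach k) \<or> stage s c = {p..e} \<or> stage s c = {q..w}"
  by (cases c) (simp add: stage_def, blast)

lemma stage_subset: "stage s c \<subseteq> {p..w}"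
  using stage_cases[of s c] by (elim disjE exE) (use approach_subset order in simp_all)

lemma stage_compact: "compact (stage s c)"
  using stage_cases[of s c] by (auto simp: approach_def)

lemma stage_nonempty: "stage s c \<noteq> {}"
  using stage_cases[of s c] by (elim disjE exE) (use order in \<open>simp_all add: approach_def\<close>)

text \<open>The approach runs down to \<open>approach 0\<close>, which is \<open>{e..q}\<close> and
  covers \<open>{p..e}\<close>. That interval covers \<open>{e..w}\<close>, hence both choices of
  the code bit, and both branches end in a set covering \<open>{e..q}\<close>, where the next stage
  starts.\<close>

lemma stage_covers:
  "stage s (clock (Suc t)) \<subseteq> f ` stage s (clock t)"
proof -
  obtain n j where nj: "clock t = (n, j)" by (cases "clock t")
  then have "j \<le> 2 * n + 3" using clock_bound[of t] by simp
  then consider "j < 2 * n" | "j = 2 * n" | "j = 2 * n + 1" | "j = 2 * n + 2" | "j = 2 * n + 3"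
    by linarith
  then show ?thesis
  proof cases
    case 1
    then have "2 * n - j = Suc (2 * n - Suc j)" by simp
    then show ?thesis
      using approach_covers[of "2 * n - Suc j"] 1 nj by (simp add: stage_def)
  next
    case 2
    then show ?thesis using right_covers nj by (simp add: stage_def approach_even b0)
  next
    case 3
    then have "stage s (clock (Suc t)) \<subseteq> {e..w}"
      using approach_even_subset[of 2] order nj by (auto simp: stage_def)
    also have "\<dots> \<subseteq> f ` stage s (clock t)"
      using left_covers 3 nj by (simp add: stage_def)
    finally show ?thesis .
  next
    case 4
    have "{p..e} \<subseteq> f ` {q..w}" using outer_covers order by (auto simp: subset_iff)
    moreover have "approach 1 \<subseteq> f ` approach 2"
      using approach_covers[of 1] by (simp add: numeral_2_eq_2)
    ultimately show ?thesis using 4 nj by (simp add: stage_def)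
  next
    case 5
    have "{e..q} \<subseteq> f ` {p..e}" using left_covers order by (auto simp: subset_iff)
    moreover have "{e..q} \<subseteq> f ` approach 1"
      using approach_covers[of 0] by (simp add: approach_even[of 0] b0)
    ultimately have "{e..q} \<subseteq> f ` stage s (clock t)"
      using 5 nj by (simp add: stage_def)
    moreover have "stage s (clock (Suc t)) \<subseteq> {e..q}"
      using approach_even_subset[of "2 * Suc n"] 5 nj by (simp add: stage_def)
    ultimately show ?thesis by blast
  qed
qed

lemma exists_coded_point: "\<exists>x. \<forall>t. (f ^^ t) x \<in> stage s (clock t)"
proof (rule exists_itinerary[of "\<lambda>t. stage s (clock t)" f])
  show "continuous_on (stage s (clock t)) f" for t
    by (rule continuous_on_subset[OF cont stage_subset])
qed (use stage_compact stage_nonempty stage_covers in blast)+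

lemma coded_points_meet:
  assumes "\<And>t. (f ^^ t) x \<in> stage s (clock t)" and "\<And>t. (f ^^ t) y \<in> stage s' (clock t)"
  shows "liminf (\<lambda>t. ereal \<bar>(f ^^ t) x - (f ^^ t) y\<bar>) = 0"
proof (rule antisym)
  let ?d = "\<lambda>t. ereal \<bar>(f ^^ t) x - (f ^^ t) y\<bar>"
  \<comment> \<open>\<open>r n\<close> is the time at which stage \<open>n\<close> starts.\<close>
  define r where "r n = n * (n + 3)" for n :: nat
  have "strict_mono r" unfolding r_def by (simp add: strict_mono_Suc_iff algebra_simps)
  have bound: "norm \<bar>(f ^^ r n) x - (f ^^ r n) y\<bar> \<le> b (2 * n) - e" for n
  proof -
    have "clock (r n) = (n, 0)" using clock_eq[of 0 n] by (simp add: r_def)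
    then have "(f ^^ r n) x \<in> {e..b (2 * n)}" "(f ^^ r n) y \<in> {e..b (2 * n)}"
      using assms[of "r n"] by (simp_all add: stage_def approach_even)
    then show ?thesis by (simp add: abs_le_iff)
  qed
  have "(\<lambda>n. \<bar>(f ^^ r n) x - (f ^^ r n) y\<bar>) \<longlonglongrightarrow> 0"
    by (rule Lim_null_comparison[OF always_eventually[OF allI[OF bound]] LIM_zero[OF b_lim]])
  then have "(?d \<circ> r) \<longlonglongrightarrow> ereal 0" unfolding comp_def by (rule tendsto_ereal)
  then have "liminf (?d \<circ> r) = 0"
    using lim_imp_Liminf[OF sequentially_bot] by (simp add: zero_ereal_def)
  then show "liminf ?d \<le> 0" using liminf_subseq_mono[OF \<open>strict_mono r\<close>, of ?d] by simp
qed (auto intro!: Liminf_bounded)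

text \<open>If \<open>i\<close> lies in only one of the sets, the bits differ at stage
  \<open>prod_encode (i, m)\<close>. There one orbit visits \<open>{q..w}\<close> while the other is
  in \<open>{e..b 2}\<close>, and a large \<open>m\<close> makes this happen late.\<close>

lemma coded_points_separate_infinitely_often:
  assumes x: "\<And>t. (f ^^ t) x \<in> stage s (clock t)" and y: "\<And>t. (f ^^ t) y \<in> stage s' (clock t)"
    and "s \<noteq> s'"
  shows "\<exists>t\<ge>m. q - b 2 \<le> \<bar>(f ^^ t) x - (f ^^ t) y\<bar>"
proof -
  obtain i where i: "(i \<in> s) \<noteq> (i \<in> s')" using \<open>s \<noteq> s'\<close> by blast
  define n where "n = prod_encode (i, m)"
  define t where "t = n * (n + 3) + (2 * n + 2)"
  have t: "clock t = (n, 2 * n + 2)" unfolding t_def by (rule clock_eq) simp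
  have bits: "code_bit s n \<noteq> code_bit s' n" using i by (simp add: code_bit_def n_def)
  have "q - b 2 \<le> \<bar>(f ^^ t) x - (f ^^ t) y\<bar>"
    using x[of t] y[of t] bits unfolding t stage_def
    by (auto simp: approach_even split: if_splits)
  moreover have "m \<le> t" using le_prod_encode_2[of m i] by (simp add: t_def n_def)
  ultimately show ?thesis by blast
qed

lemma coded_points_separate:
  assumes "\<And>t. (f ^^ t) x \<in> stage s (clock t)" and "\<And>t. (f ^^ t) y \<in> stage s' (clock t)"
    and "s \<noteq> s'"
  shows "0 < limsup (\<lambda>t. ereal \<bar>(f ^^ t) x - (f ^^ t) y\<bar>)"
proof (rule ccontr)
  assume "\<not> ?thesis"
  then have "limsup (\<lambda>t. ereal \<bar>(f ^^ t) x - (f ^^ t) y\<bar>) < ereal (q - b 2)"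
    using b2 by (simp add: not_less le_less_trans)
  then have "eventually (\<lambda>t. \<bar>(f ^^ t) x - (f ^^ t) y\<bar> < q - b 2) sequentially"
    by (auto dest: Limsup_lessD)
  then obtain m where "\<And>t. t \<ge> m \<Longrightarrow> \<bar>(f ^^ t) x - (f ^^ t) y\<bar> < q - b 2"
    by (auto simp: eventually_sequentially)
  then show False
    using coded_points_separate_infinitely_often[OF assms, of m] by (meson not_le)
qed

text \<open>One coded point is chosen for every set of naturals. Different sets give orbits that are
  apart at some time, so the choice is injective, and its range is uncountable by Cantor's
  theorem.\<close>

lemma exists_scrambled_set: "\<exists>S\<subseteq>confined. uncountable S \<and> scrambled f S"
proof -
  obtain \<xi> where \<xi>: "\<And>s t. (f ^^ t) (\<xi> s) \<in> stage s (clock t)"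
    using exists_coded_point by metis
  have "inj \<xi>"
  proof (rule injI, rule ccontr)
    fix s s' assume "\<xi> s = \<xi> s'" "s \<noteq> s'"
    then show False
      using coded_points_separate_infinitely_often[OF \<xi>[of _ s] \<xi>[of _ s'], of 0] b2 by simp
  qed
  have "uncountable (range \<xi>)"
  proof
    assume "countable (range \<xi>)"
    then have "countable (UNIV :: nat set set)" using \<open>inj \<xi>\<close> by (simp add: countable_image_inj_eq)
    then obtain g :: "nat set \<Rightarrow> nat" where "inj g" by (auto simp: countable_def)
    then have "inv g ` UNIV = Pow UNIV" using inj_imp_surj_inv[of g] by simp
    then show False using Cantors_theorem[of UNIV] by blast
  qed
  moreover have "range \<xi> \<subseteq> confined"
    using \<xi> stage_subset unfolding confined_def by blast
  moreover have "scrambled f (range \<xi>)"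
    unfolding scrambled_def
  proof (intro ballI impI)
    fix x y assume "x \<in> range \<xi>" "y \<in> range \<xi>" "x \<noteq> y"
    then obtain s s' where "x = \<xi> s" "y = \<xi> s'" "s \<noteq> s'" by blast
    then show "liminf (\<lambda>t. ereal \<bar>(f ^^ t) x - (f ^^ t) y\<bar>) = 0 \<and>
        0 < limsup (\<lambda>t. ereal \<bar>(f ^^ t) x - (f ^^ t) y\<bar>)"
      using coded_points_meet[OF \<xi> \<xi>] coded_points_separate[OF \<xi> \<xi>] by simp
  qed
  ultimately show ?thesis by blast
qed

end

theorem Li_Yorke_chaotic_confined: "Li_Yorke_chaotic confined f"
  unfolding Li_Yorke_chaotic_def
proof (intro conjI allI impI)
  show "\<exists>S\<subseteq>confined. uncountable S \<and> scrambled f S"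
    by (rule exists_backward_orbit) (rule exists_scrambled_set)
  show "continuous_on confined f" by (rule continuous_on_subset[OF cont confined_subset])
qed (rule compact_confined_set confined_invariant exists_periodic_point | assumption)+

end

section \<open>The symmetric dynamics\<close>

text \<open>At \<open>r = 3\<close> the three roots \<open>p < q < w\<close> of this cubic, namely \<open>2 - 2 * cos (2 * pi / 9)\<close> and
  its conjugates, form the 3-cycle of \<open>y + r / y - r\<close> that is born there in a tangent
  bifurcation. For larger \<open>r\<close> keep \<open>p\<close> and \<open>q\<close>, and take the image of \<open>p\<close> as \<open>w\<close>.\<close>

lemma exists_cubic_root:
  obtains p :: real where "46/100 \<le> p" "p \<le> 47/100" "p ^ 3 = 6 * p\<^sup>2 - 9 * p + 3"
proof -
  have "\<exists>p::real. 46/100 \<le> p \<and> p \<le> 47/100 \<and> p ^ 3 - 6 * p\<^sup>2 + 9 * p - 3 = 0"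
    by (rule IVT') (auto intro!: continuous_intros simp: power2_eq_square power3_eq_cube)
  then show thesis using that by fastforce
qed

lemma exists_normalized_loop:
  fixes r :: real
  assumes "r \<ge> 3"
  defines "h \<equiv> \<lambda>y. y + r * (1 / y - 1)"
  obtains p q w where "0 < p" "p < 1" "1 < q" "q \<le> 17/10" "q < w" "w \<le> h p" "h q \<le> p" "q \<le> h w"
proof -
  obtain p :: real where p: "46/100 \<le> p" "p \<le> 47/100" and cubic: "p ^ 3 = 6 * p\<^sup>2 - 9 * p + 3"
    by (rule exists_cubic_root)
  have p2: "46/100 * p \<le> p\<^sup>2" "p\<^sup>2 \<le> 47/100 * p"
    using p by (auto simp: power2_eq_square intro!: mult_right_mono)
  \<comment> \<open>The other two roots as polynomials in \<open>p\<close>: the map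
    \<open>4 * x - x\<^sup>2\<close> doubles the angle in \<open>x = 2 - 2 * cos \<theta>\<close>,
    and the three roots add up to 6.\<close>
  define q where "q = 4 * p - p\<^sup>2"
  define w3 where "w3 = p\<^sup>2 - 5 * p + 6"
  define w where "w = h p"
  have q: "1 < q" "q \<le> 17/10" using p p2 by (auto simp: q_def)
  \<comment> \<open>Modulo the cubic, the reciprocals of \<open>p\<close>, \<open>q\<close> and
    \<open>w3\<close> are polynomials in \<open>p\<close>.\<close>
  have inv_p: "1 / p = (p\<^sup>2 - 6 * p + 9) / 3"
    using p cubic by (simp add: field_simps power2_eq_square power3_eq_cube)
  have p4: "p ^ 4 = 27 * p\<^sup>2 - 51 * p + 18"
  proof -
    have "p ^ 4 = p * (6 * p\<^sup>2 - 9 * p + 3)" unfolding cubic[symmetric] by (simp add: numeral_eq_Suc)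
    also have "\<dots> = 6 * p ^ 3 - 9 * p\<^sup>2 + 3 * p"
      by (simp add: algebra_simps power2_eq_square power3_eq_cube)
    finally show ?thesis unfolding cubic by simp
  qed
  have "q * (p\<^sup>2 - 3 * p + 3) = 7 * p ^ 3 - p ^ 4 - 15 * p\<^sup>2 + 12 * p"
    by (simp add: q_def algebra_simps power2_eq_square power3_eq_cube numeral_eq_Suc)
  then have inv_q: "1 / q = (p\<^sup>2 - 3 * p + 3) / 3"
    using q p4 cubic by (simp add: field_simps)
  have "w3 * (9 * p - 2 * p\<^sup>2 - 3) = 19 * p ^ 3 - 2 * p ^ 4 - 60 * p\<^sup>2 + 69 * p - 18"
    by (simp add: w3_def algebra_simps power2_eq_square power3_eq_cube numeral_eq_Suc)
  then have w3_mult: "w3 * (9 * p - 2 * p\<^sup>2 - 3) = 3" using p4 cubic by simp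
  have w3: "w3 = p + 3 * (1 / p - 1)" by (simp add: w3_def inv_p field_simps)
  have gap: "1 / p - 1 > 1" using p by (simp add: field_simps)
  \<comment> \<open>\<open>h w\<close> is \<open>(w - r) + r / w\<close>. Each summand is at least
    its value at \<open>r = 3\<close>, namely \<open>w3 - 3\<close> and \<open>3 / w3\<close>, and
    these two add up to \<open>q\<close>.\<close>
  have w_w3: "w - r \<ge> w3 - 3"
    using mult_right_mono[of 3 r "1 / p - 2"] gap assms by (simp add: w_def h_def w3 algebra_simps)
  have "w3 > 3" using p p2 by (simp add: w3_def)
  have "w > 0" using w_w3 \<open>w3 > 3\<close> assms by linarith
  have "3 * w \<le> r * w3"
    using mult_right_mono[of 3 r p] p assms by (simp add: w_def h_def w3 algebra_simps)
  then have "3 / w3 \<le> r / w" using \<open>w3 > 3\<close> \<open>w > 0\<close> by (simp add: field_simps)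
  moreover have "3 / w3 = 9 * p - 2 * p\<^sup>2 - 3" using w3_mult \<open>w3 > 3\<close> by (simp add: field_simps)
  moreover have "h w = w - r + r / w" by (simp add: h_def algebra_simps)
  ultimately have "q \<le> h w" using w_w3 by (simp add: q_def w3_def)
  moreover have "h q \<le> p"
  proof -
    \<comment> \<open>Since \<open>q > 1\<close>, the value \<open>h q\<close> decreases in
      \<open>r\<close>; at \<open>r = 3\<close> it is \<open>p\<close>.\<close>
    have "1 / q - 1 \<le> 0" using q by simp
    then have "r * (1 / q - 1) \<le> 3 * (1 / q - 1)" using assms by (intro mult_right_mono_neg) auto
    also have "\<dots> = p - q" unfolding inv_q unfolding q_def by (simp add: field_simps)
    finally show ?thesis by (simp add: h_def)
  qed
  moreover have "q < w" using w_w3 \<open>w3 > 3\<close> q assms by linarith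
  ultimately show thesis using that[of p q w] p q by (simp add: w_def)
qed

text \<open>Scaling by \<open>e\<close> carries over the normalized loop. The distance to
  \<open>e\<close> is multiplied by \<open>\<bar>r * e / x - 1\<bar>\<close>, which is at least 2
  for \<open>0 < x \<le> e\<close> and at least 3/4 for \<open>e \<le> x \<le> 17/10 * e\<close>, as
  \<open>3 / (17/10) > 7/4\<close>.\<close>

lemma exists_repelling_loop:
  fixes e r :: real
  assumes "e > 0" and "r \<ge> 3"
  obtains p q w where "0 < p" and "repelling_loop (\<lambda>x. x + r * e * (e / x - 1)) p e q w 2 (3/4)"
proof -
  let ?f = "\<lambda>x. x + r * e * (e / x - 1)"
  let ?h = "\<lambda>y. y + r * (1 / y - 1)"
  obtain p q w where pqw: "0 < p" "p < 1" "1 < q" "q \<le> 17/10" "q < w"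
    "w \<le> ?h p" "?h q \<le> p" "q \<le> ?h w"
    using exists_normalized_loop[OF assms(2)] by blast
  have scale: "?f (e * y) = e * ?h y" for y
    using assms(1) by (simp add: algebra_simps)
  have dist: "\<bar>?f x - e\<bar> = \<bar>r * e / x - 1\<bar> * \<bar>x - e\<bar>" if "x > 0" for x
  proof -
    have "?f x - e = - ((r * e / x - 1) * (x - e))" using that by (simp add: field_simps)
    then show ?thesis by (simp only: abs_minus_cancel abs_mult)
  qed
  have ep: "0 < e * p" using assms pqw by simp
  have "repelling_loop ?f (e * p) e (e * q) (e * w) 2 (3/4)"
  proof
    show "continuous_on {e * p..e * w} ?f"
      using ep by (intro continuous_intros) auto
    show "e * w \<le> ?f (e * p)" "?f (e * q) \<le> e * p" "e * q \<le> ?f (e * w)"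
      unfolding scale using assms pqw by (auto intro!: mult_left_mono)
    show "2 * \<bar>x - e\<bar> \<le> \<bar>?f x - e\<bar>" if "x \<in> {e * p..e}" for x
    proof -
      have "x > 0" using that ep by auto
      moreover have "3 * x \<le> r * e" using that assms \<open>x > 0\<close> by (intro mult_mono) auto
      ultimately have "3 \<le> r * e / x" by (simp add: pos_le_divide_eq)
      then have "2 \<le> \<bar>r * e / x - 1\<bar>" by linarith
      then show ?thesis
        unfolding dist[OF \<open>x > 0\<close>] by (rule mult_right_mono) simp
    qed
    show "3/4 * \<bar>x - e\<bar> \<le> \<bar>?f x - e\<bar>" if "x \<in> {e..e * q}" for x
    proof -
      have "x > 0" using that assms by auto
      have "e * q \<le> e * (17/10)"
        by (rule mult_left_mono) (use pqw assms in auto)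
      then have "x \<le> 17/10 * e" using that by simp
      moreover have "3 * e \<le> r * e" using assms by simp
      ultimately have "7/4 * x \<le> r * e" using \<open>x > 0\<close> by linarith
      then have "7/4 \<le> r * e / x" using \<open>x > 0\<close> by (simp add: pos_le_divide_eq)
      then have "3/4 \<le> \<bar>r * e / x - 1\<bar>" by linarith
      then show ?thesis
        unfolding dist[OF \<open>x > 0\<close>] by (rule mult_right_mono) simp
    qed
  qed (use assms pqw in auto)
  then show thesis using that[of "e * p"] assms pqw by simp
qed

theorem theorem6:
  fixes n :: nat and \<alpha> \<eta> :: real
  assumes "n \<ge> 2"
    and "\<alpha> > 0"
    and "\<eta> \<ge> 3 * (real n - 1) / ((real n)\<^sup>2 * \<alpha>\<^sup>2)"
  shows "\<exists>X. compact X \<and> X \<subseteq> {0<..} \<and> GA_sym n \<alpha> \<eta> ` X \<subseteq> X \<and>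
           Li_Yorke_chaotic X (GA_sym n \<alpha> \<eta>)"
proof -
  \<comment> \<open>\<open>e\<close> is the fixed point, \<open>1 - r\<close> is the slope there,
    and the bound on \<open>\<eta>\<close> amounts to \<open>r \<ge> 3\<close>.\<close>
  define c where "c = (real n - 1) / (real n)\<^sup>2"
  define e where "e = c / \<alpha>"
  define r where "r = \<eta> * \<alpha>\<^sup>2 / c"
  have c: "c > 0" using assms(1) by (simp add: c_def)
  have "3 * c / \<alpha>\<^sup>2 \<le> \<eta>" using assms(3) by (simp add: c_def)
  then have "3 \<le> r" using c assms(2) by (simp add: r_def field_simps)
  have re: "r * e = \<eta> * \<alpha>" using c assms(2) by (simp add: r_def e_def power2_eq_square)
  have "GA_sym n \<alpha> \<eta> x = x + r * e * (e / x - 1)" for x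
  proof -
    have "r * e * (e / x - 1) = \<eta> * (\<alpha> * e / x - \<alpha>)" unfolding re by (simp add: algebra_simps)
    also have "\<alpha> * e = c" using assms(2) by (simp add: e_def)
    finally show ?thesis by (simp add: GA_sym_def c_def)
  qed
  then have GA: "GA_sym n \<alpha> \<eta> = (\<lambda>x. x + r * e * (e / x - 1))" by blast
  have "e > 0" using c assms(2) by (simp add: e_def)
  then obtain p q w where "0 < p" and "repelling_loop (GA_sym n \<alpha> \<eta>) p e q w 2 (3/4)"
    unfolding GA using exists_repelling_loop \<open>3 \<le> r\<close> by blast
  then interpret repelling_loop "GA_sym n \<alpha> \<eta>" p e q w 2 "3/4" by simp
  have "confined \<subseteq> {0<..}" using confined_subset \<open>0 < p\<close> by fastforce
  then show ?thesis
    using compact_confined_set confined_invariant Li_Yorke_chaotic_confined by blast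
qed

end
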